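(* Fix positive integers $k_1,\dots,k_n$ and $d_1,\dots,d_n$ with $d_i\le k_i$, and fix graphs $G_i\in\{P_{k_i}^{d_i},C_{k_i}^{d_i}\}$ for each $i\in\{1,\dots,n\}$. Define $X_i=I(d_i/k_i)$ if $G_i=P_{k_i}^{d_i}$ and $X_i=S(d_i/k_i)$ if $G_i=C_{k_i}^{d_i}$. Then for every integer $x$ with $1\le x\le\prod_{i=1}^nk_i$, $$\operatorname{iso}_{G_1\boxtimes\dots\boxtimes G_n}(x)\ \ge\ \Bigl(\prod_{i=1}^nk_i\Bigr)\cdot\operatorname{iso}_{X_1\boxtimes\dots\boxtimes X_n}\Bigl(\frac{x}{\prod_{i=1}^nk_i}\Bigr).$$
   Context: Graphs: $P_k$ is the path and $C_k$ the cycle on $k$ vertices ($C_k$ has vertex set $\mathbb Z/k\mathbb Z$ with distinct $u,v$ adjacent iff $u-v=\pm1$). For a graph $G$ and positive integer $d$, $G^d$ has the same vertex set as $G$, with distinct $u,v$ adjacent iff their distance in $G$ is at most $d$. The strong product of graphs $G_1\boxtimes\dots\boxtimes G_n$ has vertex set $V(G_1)\times\dots\times V(G_n)$, with distinct $(v_i)$, $(u_i)$ adjacent iff for each $i$ either $v_i=u_i$ or $v_iu_i\in E(G_i)$. $N_G[A]$ is the closed neighborhood (all vertices in $A$ or adjacent to a vertex in $A$), and $\operatorname{iso}_G(x)=\min\{|N_G[A]|:A\subseteq V(G),\ |A|\ge x\}$. Spaces: for $\delta\in(0,1]$, $I(\delta)$ is $[0,1]$ with Lebesgue measure and metric $\frac1\delta|x-y|$;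 $S(\delta)$ is $[0,1)$ with Lebesgue measure and metric $\frac1\delta\min\{|x-y|,1-|x-y|\}$. The strong product of such spaces is the Cartesian product with product measure and with metric the maximum of the coordinate metrics. For a space $\Omega$ with metric $d$ and measure $\mu$, $N_\Omega[A]=\{\omega\in\Omega:d(\omega,a)<1\text{ for some }a\in A\}$ and $\operatorname{iso}_\Omega(\alpha)=\inf\{\mu(N_\Omega[A]):A\text{ measurable},\ \mu(A)\ge\alpha\}$. *)

theory Defs
  imports "HOL-Analysis.Analysis" "HOL-Number_Theory.Cong" "Graph_Theory.Pair_Digraph"
begin

text \<open>
  A graph is a \<^typ>\<open>'a pair_pre_digraph\<close> whose set of arcs is a symmetric, irreflexive relation on
  its vertices. Both the path and the cycle on \<open>k\<close> vertices have vertex set \<open>{0..<k}\<close>; for the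
  cycle these are the representatives of the integers modulo \<open>k\<close>.
\<close>

definition path_graph :: "nat \<Rightarrow> int pair_pre_digraph" where
  "path_graph k =
     \<lparr>pverts = {0..<int k},
      parcs = {(u, v). u \<in> {0..<int k} \<and> v \<in> {0..<int k} \<and> \<bar>u - v\<bar> = 1}\<rparr>"

definition cycle_graph :: "nat \<Rightarrow> int pair_pre_digraph" where
  "cycle_graph k =
     \<lparr>pverts = {0..<int k},
      parcs = {(u, v). u \<in> {0..<int k} \<and> v \<in> {0..<int k} \<and> u \<noteq> v \<and>
                 ([u - v = 1] (mod int k) \<or> [u - v = -1] (mod int k))}\<rparr>"

text \<open>The distance is \<open>\<infinity>\<close> if there is no walk from \<open>u\<close> to \<open>v\<close>.\<close>

definition graph_dist :: "'a pair_pre_digraph \<Rightarrow> 'a \<Rightarrow> 'a \<Rightarrow> enat" where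
  "graph_dist G u v = (INF p \<in> {p. pre_digraph.awalk (with_proj G) u p v}. enat (length p))"

definition graph_power :: "'a pair_pre_digraph \<Rightarrow> nat \<Rightarrow> 'a pair_pre_digraph" where
  "graph_power G d =
     \<lparr>pverts = pverts G,
      parcs = {(u, v). u \<in> pverts G \<and> v \<in> pverts G \<and> u \<noteq> v \<and> graph_dist G u v \<le> enat d}\<rparr>"

definition strong_product ::
    "'i set \<Rightarrow> ('i \<Rightarrow> 'a pair_pre_digraph) \<Rightarrow> ('i \<Rightarrow> 'a) pair_pre_digraph" where
  "strong_product I G =
     \<lparr>pverts = (\<Pi>\<^sub>E i\<in>I. pverts (G i)),
      parcs = {(u, v). u \<in> (\<Pi>\<^sub>E i\<in>I. pverts (G i)) \<and> v \<in> (\<Pi>\<^sub>E i\<in>I. pverts (G i)) \<and> u \<noteq> v \<and>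
                 (\<forall>i\<in>I. u i = v i \<or> (u i, v i) \<in> parcs (G i))}\<rparr>"

definition graph_nbhd :: "'a pair_pre_digraph \<Rightarrow> 'a set \<Rightarrow> 'a set" where
  "graph_nbhd G A = {v \<in> pverts G. v \<in> A \<or> (\<exists>a\<in>A. (v, a) \<in> parcs G)}"

text \<open>Meaningful for a finite graph \<open>G\<close> and \<open>x \<le> card (pverts G)\<close>, when the minimum is over a
  finite nonempty set.\<close>

definition graph_iso :: "'a pair_pre_digraph \<Rightarrow> nat \<Rightarrow> nat" where
  "graph_iso G x = Min {card (graph_nbhd G A) | A. A \<subseteq> pverts G \<and> card A \<ge> x}"

text \<open>The set of points of a space is \<open>space (mms_measure \<Omega>)\<close>; only the values of \<open>mms_dist \<Omega>\<close> on
  it matter.\<close>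

record 'a mm_space =
  mms_measure :: "'a measure"
  mms_dist :: "'a \<Rightarrow> 'a \<Rightarrow> real"

definition interval_space :: "real \<Rightarrow> real mm_space" where
  "interval_space \<delta> =
     \<lparr>mms_measure = lebesgue_on {0..1},
      mms_dist = (\<lambda>x y. 1 / \<delta> * \<bar>x - y\<bar>)\<rparr>"

definition circle_space :: "real \<Rightarrow> real mm_space" where
  "circle_space \<delta> =
     \<lparr>mms_measure = lebesgue_on {0..<1},
      mms_dist = (\<lambda>x y. 1 / \<delta> * min \<bar>x - y\<bar> (1 - \<bar>x - y\<bar>))\<rparr>"

text \<open>For a finite nonempty index set.\<close>

definition mms_product :: "'i set \<Rightarrow> ('i \<Rightarrow> 'a mm_space) \<Rightarrow> ('i \<Rightarrow> 'a) mm_space" where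
  "mms_product I X =
     \<lparr>mms_measure = (\<Pi>\<^sub>M i\<in>I. mms_measure (X i)),
      mms_dist = (\<lambda>x y. Max ((\<lambda>i. mms_dist (X i) (x i) (y i)) ` I))\<rparr>"

definition mms_nbhd :: "'a mm_space \<Rightarrow> 'a set \<Rightarrow> 'a set" where
  "mms_nbhd \<Omega> A = {\<omega> \<in> space (mms_measure \<Omega>). \<exists>a\<in>A. mms_dist \<Omega> \<omega> a < 1}"

text \<open>
  In finite products of intervals and circles, \<open>mms_nbhd \<Omega> A\<close> is a union of open balls, hence open
  in a second-countable topology and a measurable set. The infimum is over a nonempty set
  if \<open>\<alpha>\<close> is at most the total measure of \<open>\<Omega>\<close>.
\<close>

definition mms_iso :: "'a mm_space \<Rightarrow> real \<Rightarrow> real" where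
  "mms_iso \<Omega> \<alpha> =
     Inf {measure (mms_measure \<Omega>) (mms_nbhd \<Omega> A) | A.
            A \<in> sets (mms_measure \<Omega>) \<and> measure (mms_measure \<Omega>) A \<ge> \<alpha>}"

end

theory Submission
  imports Defs "HOL-Probability.Probability_Measure"
begin

text \<open>
  The graph inequality is obtained by blowing up vertices to cells. Cut \<open>[0,1]\<close> (or the circle) into
  \<open>k\<close> cells of length \<open>1/k\<close> and name the cells by the vertices \<open>0, \<dots>, k - 1\<close>. Two points at
  Euclidean (or circular) distance less than \<open>d/k\<close> lie in cells whose numbers differ by at most
  \<open>d\<close> (on the circle: modulo \<open>k\<close>), that is, in cells named by vertices that are equal or adjacent
  in the \<open>d\<close>-th power of the path (or cycle).

  Such a naming of cells, called a cell map below, is what makes the continuous isoperimetric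
  problem a lower bound for the discrete one: a vertex set \<open>A\<close> becomes the union of its cells, of
  measure \<open>|A|/|V|\<close>, and the neighbourhood of that union stays within the cells of the closed
  neighbourhood of \<open>A\<close>, so its measure is at most \<open>|N[A]|/|V|\<close> (\<open>cell_map.mms_iso_le_graph_iso\<close>).
  Both the strong product of graphs and the product of spaces are taken coordinatewise, so cell
  maps multiply (\<open>cell_map_product\<close>), and it remains to treat one path or one cycle.
\<close>

section \<open>Cell maps and the isoperimetric inequality\<close>

locale cell_map = prob_space "mms_measure \<Omega>"
  for G :: "'v pair_pre_digraph" and \<Omega> :: "'a mm_space" and c :: "'a \<Rightarrow> 'v" +
  assumes finite_verts: "finite (pverts G)"
    and cell_in_verts: "\<omega> \<in> space (mms_measure \<Omega>) \<Longrightarrow> c \<omega> \<in> pverts G"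
    and cell_sets: "v \<in> pverts G \<Longrightarrow>
          {\<omega> \<in> space (mms_measure \<Omega>). c \<omega> = v} \<in> sets (mms_measure \<Omega>)"
    and cell_measure: "v \<in> pverts G \<Longrightarrow>
          measure (mms_measure \<Omega>) {\<omega> \<in> space (mms_measure \<Omega>). c \<omega> = v} = 1 / card (pverts G)"
    and close_cells: "\<omega> \<in> space (mms_measure \<Omega>) \<Longrightarrow> \<omega>' \<in> space (mms_measure \<Omega>) \<Longrightarrow>
          mms_dist \<Omega> \<omega> \<omega>' < 1 \<Longrightarrow> c \<omega> = c \<omega>' \<or> (c \<omega>, c \<omega>') \<in> parcs G"
begin

definition cells :: "'v set \<Rightarrow> 'a set" where
  "cells A = {\<omega> \<in> space (mms_measure \<Omega>). c \<omega> \<in> A}"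

lemma cells_eq_Union:
  "cells A = (\<Union>v\<in>A. {\<omega> \<in> space (mms_measure \<Omega>). c \<omega> = v})"
  by (auto simp: cells_def)

lemma cells_sets:
  assumes "A \<subseteq> pverts G"
  shows "cells A \<in> sets (mms_measure \<Omega>)"
  unfolding cells_eq_Union
  using assms finite_subset[OF assms finite_verts] cell_sets by (intro sets.finite_UN) auto

lemma measure_cells:
  assumes "A \<subseteq> pverts G"
  shows "measure (mms_measure \<Omega>) (cells A) = card A / card (pverts G)"
proof -
  have "measure (mms_measure \<Omega>) (cells A)
      = (\<Sum>v\<in>A. measure (mms_measure \<Omega>) {\<omega> \<in> space (mms_measure \<Omega>). c \<omega> = v})"
    unfolding cells_eq_Union
    using finite_subset[OF assms finite_verts] assms cell_sets
    by (intro finite_measure_finite_Union) (auto simp: disjoint_family_on_def)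
  also have "\<dots> = (\<Sum>v\<in>A. 1 / card (pverts G))"
    using assms cell_measure by (intro sum.cong) auto
  finally show ?thesis by simp
qed

lemma nbhd_cells_subset: "mms_nbhd \<Omega> (cells A) \<subseteq> cells (graph_nbhd G A)"
  using close_cells cell_in_verts by (fastforce simp: mms_nbhd_def cells_def graph_nbhd_def)

lemma measure_nbhd_cells_le:
  "measure (mms_measure \<Omega>) (mms_nbhd \<Omega> (cells A)) \<le> card (graph_nbhd G A) / card (pverts G)"
proof -
  have nbhd_verts: "graph_nbhd G A \<subseteq> pverts G"
    by (auto simp: graph_nbhd_def)
  have "measure (mms_measure \<Omega>) (mms_nbhd \<Omega> (cells A))
      \<le> measure (mms_measure \<Omega>) (cells (graph_nbhd G A))"
    using nbhd_cells_subset cells_sets[OF nbhd_verts] by (rule finite_measure_mono)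
  then show ?thesis
    by (simp add: measure_cells[OF nbhd_verts])
qed

theorem mms_iso_le_graph_iso:
  assumes "x \<le> card (pverts G)"
  shows "card (pverts G) * mms_iso \<Omega> (x / card (pverts G)) \<le> graph_iso G x"
proof -
  let ?S = "{card (graph_nbhd G A) | A. A \<subseteq> pverts G \<and> card A \<ge> x}"
  have "?S \<subseteq> (\<lambda>A. card (graph_nbhd G A)) ` Pow (pverts G)" by auto
  then have "finite ?S"
    using finite_verts by (meson finite_Pow_iff finite_imageI finite_subset)
  moreover have "?S \<noteq> {}" using assms by blast
  ultimately have "graph_iso G x \<in> ?S"
    unfolding graph_iso_def by (rule Min_in)
  then obtain A where A: "A \<subseteq> pverts G" "card A \<ge> x"
    and iso: "graph_iso G x = card (graph_nbhd G A)" by blast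
  have "mms_iso \<Omega> (x / card (pverts G)) \<le> measure (mms_measure \<Omega>) (mms_nbhd \<Omega> (cells A))"
    unfolding mms_iso_def
  proof (rule cInf_lower)
    have "x / card (pverts G) \<le> measure (mms_measure \<Omega>) (cells A)"
      using A by (simp add: measure_cells divide_right_mono)
    then show "measure (mms_measure \<Omega>) (mms_nbhd \<Omega> (cells A)) \<in>
        {measure (mms_measure \<Omega>) (mms_nbhd \<Omega> B) | B.
          B \<in> sets (mms_measure \<Omega>) \<and> x / card (pverts G) \<le> measure (mms_measure \<Omega>) B}"
      using cells_sets[OF A(1)] by blast
    show "bdd_below {measure (mms_measure \<Omega>) (mms_nbhd \<Omega> B) | B.
          B \<in> sets (mms_measure \<Omega>) \<and> x / card (pverts G) \<le> measure (mms_measure \<Omega>) B}"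
      by (rule bdd_belowI[of _ 0]) auto
  qed
  also have "\<dots> \<le> card (graph_nbhd G A) / card (pverts G)"
    by (rule measure_nbhd_cells_le)
  finally have "card (pverts G) * mms_iso \<Omega> (x / card (pverts G))
      \<le> card (pverts G) * (card (graph_nbhd G A) / card (pverts G))"
    by (rule mult_left_mono) simp
  also have "\<dots> \<le> card (graph_nbhd G A)" by simp
  finally show ?thesis by (simp add: iso)
qed

end

section \<open>Products of cell maps\<close>

lemma card_pverts_strong_product:
  "finite I \<Longrightarrow> card (pverts (strong_product I G)) = (\<Prod>i\<in>I. card (pverts (G i)))"
  by (simp add: strong_product_def card_PiE)

text \<open>
  The cells of the product are the boxes of cells of the factors, whose measures multiply. A maximum
  of coordinate distances is below \<open>1\<close> iff all of them are, just as adjacency in the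
  strong product asks for equality or adjacency in every coordinate.
\<close>

lemma cell_map_product:
  fixes G :: "'i \<Rightarrow> 'v pair_pre_digraph" and X :: "'i \<Rightarrow> 'a mm_space"
  assumes I: "finite I" "I \<noteq> {}"
    and cell: "\<And>i. i \<in> I \<Longrightarrow> cell_map (G i) (X i) (c i)"
  shows "cell_map (strong_product I G) (mms_product I X) (\<lambda>\<omega>. \<lambda>i\<in>I. c i (\<omega> i))"
proof -
  obtain j where j: "j \<in> I" using I by blast
  \<comment> \<open>The locale for product measures speaks about every index of the type, so the factors outside
    \<open>I\<close>, which do not enter the product, are replaced by a probability space.\<close>
  define M where "M i = (if i \<in> I then mms_measure (X i) else mms_measure (X j))" for i
  have PiM_eq: "mms_measure (mms_product I X) = PiM I M"
    by (auto simp: mms_product_def M_def intro!: PiM_cong)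
  have "prob_space (M i)" for i
    using cell j by (auto simp: M_def cell_map_def)
  then interpret P: finite_product_prob_space M I
    using I
    by (intro finite_product_prob_space.intro finite_product_sigma_finite.intro
        product_sigma_finite.intro finite_product_sigma_finite_axioms.intro
        product_prob_space.intro product_prob_space_axioms.intro)
      (auto intro: prob_space_imp_sigma_finite)
  have space_eq: "space (mms_measure (mms_product I X)) = (\<Pi>\<^sub>E i\<in>I. space (mms_measure (X i)))"
    by (auto simp: PiM_eq space_PiM M_def PiE_def Pi_def)
  have verts_eq: "pverts (strong_product I G) = (\<Pi>\<^sub>E i\<in>I. pverts (G i))"
    by (simp add: strong_product_def)
  let ?c = "\<lambda>\<omega>. \<lambda>i\<in>I. c i (\<omega> i)"
  define F where "F v i = {\<omega> \<in> space (mms_measure (X i)). c i \<omega> = v i}" for v i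
  have box: "{\<omega> \<in> space (mms_measure (mms_product I X)). ?c \<omega> = v} = (\<Pi>\<^sub>E i\<in>I. F v i)"
    if "v \<in> pverts (strong_product I G)" for v
  proof -
    have "?c \<omega> = v \<longleftrightarrow> (\<forall>i\<in>I. c i (\<omega> i) = v i)" for \<omega>
      using that unfolding verts_eq by (auto simp: PiE_def extensional_def fun_eq_iff)
    then show ?thesis
      unfolding space_eq F_def by (auto simp: PiE_iff extensional_def)
  qed
  have F_sets: "F v i \<in> sets (M i)" and F_measure: "measure (M i) (F v i) = 1 / card (pverts (G i))"
    if "v \<in> pverts (strong_product I G)" "i \<in> I" for v i
  proof -
    have "v i \<in> pverts (G i)" using that by (auto simp: verts_eq)
    then show "F v i \<in> sets (M i)" "measure (M i) (F v i) = 1 / card (pverts (G i))"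
      using cell_map.cell_sets[OF cell] cell_map.cell_measure[OF cell] \<open>i \<in> I\<close>
      by (simp_all add: F_def M_def)
  qed
  show ?thesis
  proof (intro cell_map.intro cell_map_axioms.intro)
    show "prob_space (mms_measure (mms_product I X))"
      unfolding PiM_eq by (rule P.prob_space_axioms)
    show "finite (pverts (strong_product I G))"
      unfolding verts_eq using I cell_map.finite_verts[OF cell] by (intro finite_PiE) auto
    show "?c \<omega> \<in> pverts (strong_product I G)"
      if "\<omega> \<in> space (mms_measure (mms_product I X))" for \<omega>
      using that cell_map.cell_in_verts[OF cell] unfolding verts_eq space_eq by auto
    show "{\<omega> \<in> space (mms_measure (mms_product I X)). ?c \<omega> = v}
        \<in> sets (mms_measure (mms_product I X))"
      if "v \<in> pverts (strong_product I G)" for v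
      unfolding box[OF that] unfolding PiM_eq
      using I F_sets[OF that] by (intro sets_PiM_I_finite) auto
    show "measure (mms_measure (mms_product I X))
        {\<omega> \<in> space (mms_measure (mms_product I X)). ?c \<omega> = v}
        = 1 / card (pverts (strong_product I G))"
      if "v \<in> pverts (strong_product I G)" for v
    proof -
      have "measure (PiM I M) (\<Pi>\<^sub>E i\<in>I. F v i) = (\<Prod>i\<in>I. measure (M i) (F v i))"
        using F_sets[OF that] by (intro P.prob_times) auto
      also have "\<dots> = (\<Prod>i\<in>I. 1 / card (pverts (G i)))"
        using F_measure[OF that] by (intro prod.cong) auto
      finally show ?thesis
        unfolding box[OF that] unfolding PiM_eq
        using I by (simp add: card_pverts_strong_product prod_dividef)
    qed
    show "?c \<omega> = ?c \<omega>' \<or> (?c \<omega>, ?c \<omega>') \<in> parcs (strong_product I G)"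
      if \<omega>: "\<omega> \<in> space (mms_measure (mms_product I X))"
        "\<omega>' \<in> space (mms_measure (mms_product I X))"
        and close: "mms_dist (mms_product I X) \<omega> \<omega>' < 1" for \<omega> \<omega>'
    proof -
      have "mms_dist (X i) (\<omega> i) (\<omega>' i) < 1" if "i \<in> I" for i
        using close that I by (auto simp: mms_product_def)
      then have "\<forall>i\<in>I. c i (\<omega> i) = c i (\<omega>' i) \<or> (c i (\<omega> i), c i (\<omega>' i)) \<in> parcs (G i)"
        using \<omega> cell_map.close_cells[OF cell] unfolding space_eq by (auto simp: PiE_iff)
      moreover have "?c \<omega> \<in> (\<Pi>\<^sub>E i\<in>I. pverts (G i))" "?c \<omega>' \<in> (\<Pi>\<^sub>E i\<in>I. pverts (G i))"
        using \<omega> cell_map.cell_in_verts[OF cell] unfolding space_eq by auto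
      ultimately show ?thesis
        by (auto simp: strong_product_def)
    qed
  qed
qed

section \<open>Adjacency in powers of paths and cycles\<close>

lemma graph_dist_le_walk_length:
  assumes "f 0 \<in> pverts G" and "\<And>i. i < m \<Longrightarrow> (f i, f (Suc i)) \<in> parcs G"
  shows "graph_dist G (f 0) (f m) \<le> enat m"
proof -
  let ?p = "map (\<lambda>i. (f i, f (Suc i))) [0..<m]"
  have "pre_digraph.cas (with_proj G) (f a) (map (\<lambda>i. (f i, f (Suc i))) [a..<a + j]) (f (a + j))"
    for a j
  proof (induction j arbitrary: a)
    case 0
    then show ?case by (simp add: pre_digraph.cas.simps)
  next
    case (Suc j)
    from Suc[of "Suc a"] show ?case by (simp add: pre_digraph.cas.simps upt_conv_Cons del: upt_Suc)
  qed
  from this[of 0 m] have "pre_digraph.awalk (with_proj G) (f 0) ?p (f m)"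
    using assms by (auto simp: pre_digraph.awalk_def)
  moreover have "length ?p = m" by simp
  ultimately show ?thesis
    unfolding graph_dist_def by (metis (mono_tags, lifting) INF_lower mem_Collect_eq)
qed

lemma path_power_adjacent:
  assumes "u \<in> {0..<int k}" "v \<in> {0..<int k}" "u \<noteq> v" "\<bar>u - v\<bar> \<le> int d"
  shows "(u, v) \<in> parcs (graph_power (path_graph k) d)"
proof -
  define f where "f i = u + sgn (v - u) * int i" for i
  have end_f: "f 0 = u" "f (nat \<bar>u - v\<bar>) = v"
    by (auto simp: f_def sgn_if)
  have "graph_dist (path_graph k) (f 0) (f (nat \<bar>u - v\<bar>)) \<le> enat (nat \<bar>u - v\<bar>)"
    using assms by (intro graph_dist_le_walk_length) (auto simp: f_def path_graph_def sgn_if)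
  also have "\<dots> \<le> enat d" using assms by simp
  finally show ?thesis
    using assms by (simp add: end_f graph_power_def path_graph_def)
qed

text \<open>
  Here \<open>s\<close> is the direction of travel and \<open>m\<close> the number of steps. Both directions are needed, since
  the shorter way from \<open>u\<close> to \<open>v\<close> may be the one that passes from \<open>k - 1\<close> to \<open>0\<close> or back.
\<close>

lemma cycle_power_adjacent:
  assumes "u \<in> {0..<int k}" "v \<in> {0..<int k}" "u \<noteq> v"
    and "\<bar>s\<bar> = 1" "m \<le> d" "[v = u + s * int m] (mod int k)"
  shows "(u, v) \<in> parcs (graph_power (cycle_graph k) d)"
proof -
  define f where "f i = (u + s * int i) mod int k" for i
  have k: "k \<ge> 2" using assms(1-3) by auto
  have end_f: "f 0 = u" "f m = v"
    using assms by (auto simp: f_def cong_def)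
  have "(f i, f (Suc i)) \<in> parcs (cycle_graph k)" for i
  proof -
    have "[f (Suc i) - f i = (u + s * int (Suc i)) - (u + s * int i)] (mod int k)"
      unfolding f_def by (intro cong_diff) (simp_all add: cong_def)
    then have step: "[f (Suc i) - f i = s] (mod int k)"
      by (simp add: algebra_simps)
    then have step': "[f i - f (Suc i) = - s] (mod int k)"
      using cong_minus_minus_iff[of "f (Suc i) - f i" s "int k"] by simp
    have s: "s = 1 \<or> s = -1" using assms(4) by linarith
    have "f (Suc i) \<noteq> f i"
    proof
      assume "f (Suc i) = f i"
      with step have "int k dvd s" by (simp add: cong_0_iff cong_sym_eq[of 0])
      with s k show False by auto
    qed
    with step' s k show ?thesis
      by (auto simp: cycle_graph_def f_def)
  qed
  then have "graph_dist (cycle_graph k) (f 0) (f m) \<le> enat m"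
    using assms end_f by (intro graph_dist_le_walk_length) (auto simp: cycle_graph_def)
  also have "\<dots> \<le> enat d" using assms by simp
  finally show ?thesis
    using assms by (simp add: end_f graph_power_def cycle_graph_def)
qed

section \<open>Cell maps of intervals and circles\<close>

text \<open>
  On \<open>[0,1]\<close> the minimum only affects the point \<open>1\<close>, which belongs to the interval but to none of the half-open
  cells; it joins the last cell.
\<close>

definition cell_index :: "nat \<Rightarrow> real \<Rightarrow> int" where
  "cell_index k x = min \<lfloor>k * x\<rfloor> (int k - 1)"

lemma cell_index_in:
  assumes "k \<ge> 1" "x \<in> {0..1}"
  shows "cell_index k x \<in> {0..<int k}"
  using assms by (auto simp: cell_index_def)

lemma cell_index_half_open:
  assumes "k \<ge> 1" "x \<in> {0..<1}"
  shows "cell_index k x = \<lfloor>k * x\<rfloor>"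
proof -
  have "k * x < k" using assms by simp
  then have "\<lfloor>k * x\<rfloor> < int k" by (simp add: floor_less_iff)
  then show ?thesis by (simp add: cell_index_def)
qed

text \<open>
  The difference of the integer parts of two reals less than \<open>d\<close> apart is an integer below \<open>d + 1\<close>,
  and truncation by the minimum does not increase distances.
\<close>

lemma cell_index_diff_le:
  assumes "\<bar>k * x - k * y\<bar> < real d"
  shows "\<bar>cell_index k x - cell_index k y\<bar> \<le> int d"
proof -
  have "\<bar>\<lfloor>k * x\<rfloor> - \<lfloor>k * y\<rfloor>\<bar> \<le> int d"
    using assms by linarith
  then show ?thesis unfolding cell_index_def by linarith
qed

text \<open>
  Interval and circle are treated together: their underlying sets \<open>S\<close> differ only in the point \<open>1\<close>.
  Only the last cell depends on this, and every cell lies between a half-open interval and its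
  closure, both of length \<open>1/k\<close>.
\<close>

lemma cell_index_fibre:
  assumes S: "{0..<1} \<subseteq> S" "S \<subseteq> {0..1}" "S \<in> sets lebesgue"
    and k: "k \<ge> 1" and v: "v \<in> {0..<int k}"
  shows "{x \<in> S. cell_index k x = v} \<in> sets (lebesgue_on S)"
    and "measure (lebesgue_on S) {x \<in> S. cell_index k x = v} = 1 / k"
proof -
  let ?F = "{x \<in> S. cell_index k x = v}"
  have lower: "{v / k..<(v + 1) / k} \<subseteq> ?F"
  proof
    fix x assume x: "x \<in> {v / k..<(v + 1) / k}"
    then have "v \<le> k * x" "k * x < v + 1"
      using k by (auto simp: field_simps)
    moreover from this have "\<lfloor>k * x\<rfloor> = v" by linarith
    moreover have "0 \<le> x" using x v by (auto intro: order_trans[rotated])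
    moreover have "x < 1"
    proof -
      have "real_of_int (v + 1) \<le> real_of_int (int k)" using v unfolding of_int_le_iff by simp
      then have "k * x < k * 1" using \<open>k * x < v + 1\<close> by simp
      then show ?thesis using k by (simp add: mult_less_cancel_left)
    qed
    ultimately show "x \<in> ?F" using S v by (auto simp: cell_index_def)
  qed
  have upper: "?F \<subseteq> {v / k..(v + 1) / k}"
  proof
    fix x assume x: "x \<in> ?F"
    then have "k * x \<le> k" using S k by (auto simp: mult_left_le)
    then have "v \<le> k * x" "k * x \<le> v + 1"
      using x unfolding cell_index_def by (auto simp: min_def split: if_splits) linarith+
    then show "x \<in> {v / k..(v + 1) / k}" using k by (auto simp: field_simps)
  qed
  have "cell_index k \<in> borel_measurable borel"
    unfolding cell_index_def by measurable
  then have "cell_index k -` {v} \<inter> space lebesgue \<in> sets lebesgue"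
    by (intro measurable_sets[of _ lebesgue borel] measurable_completion) auto
  moreover have "?F = (cell_index k -` {v} \<inter> space lebesgue) \<inter> S" by auto
  ultimately have F: "?F \<in> sets lebesgue" using S by auto
  then show "?F \<in> sets (lebesgue_on S)"
    using S by (simp add: sets_restrict_space_iff)
  have len: "(v + 1) / k - v / k = 1 / k" by (simp add: add_divide_distrib)
  have closed_cell: "{v / k..(v + 1) / k} \<in> lmeasurable"
    by (auto intro: bounded_set_imp_lmeasurable)
  then have F': "?F \<in> lmeasurable"
    using upper F by (rule fmeasurableI2)
  have "v / k \<le> (v + 1) / k" by (simp add: divide_right_mono)
  moreover have "measure lebesgue {v / k..<(v + 1) / k} \<le> measure lebesgue ?F"
    using lower _ F' by (rule measure_mono_fmeasurable) simp
  moreover have "measure lebesgue ?F \<le> measure lebesgue {v / k..(v + 1) / k}"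
    using upper F closed_cell by (rule measure_mono_fmeasurable)
  ultimately have "measure lebesgue ?F = 1 / k"
    using len by simp
  then show "measure (lebesgue_on S) ?F = 1 / k"
    using S by (subst measure_restrict_space) auto
qed

lemma prob_space_lebesgue_on_unit:
  assumes S: "{0..<1} \<subseteq> S" "S \<subseteq> {0..1::real}" "S \<in> sets lebesgue"
  shows "prob_space (lebesgue_on S)"
proof
  have "emeasure lebesgue {0..<1::real} \<le> emeasure lebesgue S"
    using S by (intro emeasure_mono) auto
  moreover have "emeasure lebesgue S \<le> emeasure lebesgue {0..1::real}"
    using S by (intro emeasure_mono) auto
  ultimately have "emeasure lebesgue S = 1" by simp
  then show "emeasure (lebesgue_on S) (space (lebesgue_on S)) = 1"
    using S by (simp add: emeasure_restrict_space)
qed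

lemma pverts_power:
  "pverts (graph_power (path_graph k) d) = {0..<int k}"
  "pverts (graph_power (cycle_graph k) d) = {0..<int k}"
  by (simp_all add: graph_power_def path_graph_def cycle_graph_def)

lemma cell_map_unit:
  assumes S: "{0..<1} \<subseteq> S" "S \<subseteq> {0..1}" "S \<in> sets lebesgue"
    and "k \<ge> 1" "pverts G = {0..<int k}" "mms_measure \<Omega> = lebesgue_on S"
    and "\<And>x y. x \<in> S \<Longrightarrow> y \<in> S \<Longrightarrow> mms_dist \<Omega> x y < 1 \<Longrightarrow> cell_index k x \<noteq> cell_index k y \<Longrightarrow>
           (cell_index k x, cell_index k y) \<in> parcs G"
  shows "cell_map G \<Omega> (cell_index k)"
proof (intro cell_map.intro cell_map_axioms.intro)
  show "prob_space (mms_measure \<Omega>)"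
    using prob_space_lebesgue_on_unit[OF S] assms by simp
  show "cell_index k x = cell_index k y \<or> (cell_index k x, cell_index k y) \<in> parcs G"
    if "x \<in> space (mms_measure \<Omega>)" "y \<in> space (mms_measure \<Omega>)" "mms_dist \<Omega> x y < 1" for x y
    using that assms(6,7) by auto
qed (use assms(2,4-6) cell_index_in[of k] cell_index_fibre[OF S] in auto)

lemma cell_map_path:
  assumes "k \<ge> 1" "d \<ge> 1"
  shows "cell_map (graph_power (path_graph k) d) (interval_space (d / k)) (cell_index k)"
proof (rule cell_map_unit)
  fix x y :: real
  assume xy: "x \<in> {0..1}" "y \<in> {0..1}" and ne: "cell_index k x \<noteq> cell_index k y"
    and "mms_dist (interval_space (d / k)) x y < 1"
  then have "k * \<bar>x - y\<bar> < d"
    using assms by (simp add: interval_space_def field_simps)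
  then have "\<bar>k * x - k * y\<bar> < d"
    by (simp add: abs_mult flip: right_diff_distrib)
  then show "(cell_index k x, cell_index k y) \<in> parcs (graph_power (path_graph k) d)"
    using assms xy ne cell_index_diff_le by (intro path_power_adjacent cell_index_in) auto
qed (use assms in \<open>auto simp: pverts_power interval_space_def\<close>)

text \<open>
  A circular distance below \<open>d/k\<close> is realised either directly or across the point \<open>0\<close>. In the second
  case it is the complement \<open>k - \<bar>u - v\<bar>\<close> of the difference of the cell numbers that is at most \<open>d\<close>.
\<close>

lemma cell_map_cycle:
  assumes "k \<ge> 1" "d \<ge> 1"
  shows "cell_map (graph_power (cycle_graph k) d) (circle_space (d / k)) (cell_index k)"
proof (rule cell_map_unit)
  fix x y :: real
  assume xy: "x \<in> {0..<1}" "y \<in> {0..<1}" and ne: "cell_index k x \<noteq> cell_index k y"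
    and "mms_dist (circle_space (d / k)) x y < 1"
  then have "k * min \<bar>x - y\<bar> (1 - \<bar>x - y\<bar>) < d"
    using assms by (simp add: circle_space_def field_simps)
  then have "k * \<bar>x - y\<bar> < d \<or> k * (1 - \<bar>x - y\<bar>) < d"
    by (simp add: min_def split: if_splits)
  moreover have "k * \<bar>x - y\<bar> = \<bar>k * x - k * y\<bar>"
    by (simp add: abs_mult flip: right_diff_distrib)
  ultimately have close: "\<bar>k * x - k * y\<bar> < d \<or> k - \<bar>k * x - k * y\<bar> < d"
    by (simp add: right_diff_distrib)
  let ?u = "cell_index k x" and ?v = "cell_index k y"
  have uv: "?u \<in> {0..<int k}" "?v \<in> {0..<int k}"
    using assms xy by (intro cell_index_in; simp)+
  have floors: "?u = \<lfloor>k * x\<rfloor>" "?v = \<lfloor>k * y\<rfloor>"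
    using assms xy by (simp_all add: cell_index_half_open)
  have "\<bar>?u - ?v\<bar> \<le> int d \<or> int k - \<bar>?u - ?v\<bar> \<le> int d"
    using close unfolding floors by linarith
  then show "(?u, ?v) \<in> parcs (graph_power (cycle_graph k) d)"
  proof
    assume "\<bar>?u - ?v\<bar> \<le> int d"
    then show ?thesis
      using uv ne by (intro cycle_power_adjacent[of _ _ _ "sgn (?v - ?u)" "nat \<bar>?u - ?v\<bar>"])
        (auto simp: sgn_if)
  next
    \<comment> \<open>The short way round crosses the point \<open>0\<close>, hence goes in the direction opposite to the
      difference of the representatives.\<close>
    assume "int k - \<bar>?u - ?v\<bar> \<le> int d"
    moreover have "[?v = ?u + sgn (?u - ?v) * (int k - \<bar>?u - ?v\<bar>)] (mod int k)"
      using ne by (auto simp: sgn_if cong_iff_dvd_diff)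
    ultimately show ?thesis
      using uv ne by (intro cycle_power_adjacent[of _ _ _ "sgn (?u - ?v)" "nat (int k - \<bar>?u - ?v\<bar>)"])
        (auto simp: sgn_if)
  qed
qed (use assms in \<open>auto simp: pverts_power circle_space_def\<close>)

section \<open>The isoperimetric inequality for strong products\<close>

theorem theorem8p2:
  fixes n :: nat and k d :: "nat \<Rightarrow> nat"
    and G :: "nat \<Rightarrow> int pair_pre_digraph" and X :: "nat \<Rightarrow> real mm_space" and x :: nat
  assumes "n \<ge> 1"
    and "\<And>i. i \<in> {1..n} \<Longrightarrow> k i \<ge> 1"
    and "\<And>i. i \<in> {1..n} \<Longrightarrow> d i \<ge> 1"
    and "\<And>i. i \<in> {1..n} \<Longrightarrow> d i \<le> k i"
    and "\<And>i. i \<in> {1..n} \<Longrightarrow>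
           G i = graph_power (path_graph (k i)) (d i) \<and>
             X i = interval_space (real (d i) / real (k i)) \<or>
           G i = graph_power (cycle_graph (k i)) (d i) \<and>
             X i = circle_space (real (d i) / real (k i))"
    and "1 \<le> x" and "x \<le> (\<Prod>i\<in>{1..n}. k i)"
  shows "real (graph_iso (strong_product {1..n} G) x)
    \<ge> real (\<Prod>i\<in>{1..n}. k i) *
      mms_iso (mms_product {1..n} X) (real x / real (\<Prod>i\<in>{1..n}. k i))"
proof -
  have "cell_map (G i) (X i) (cell_index (k i))" if "i \<in> {1..n}" for i
    using assms(5)[OF that] cell_map_path cell_map_cycle assms(2,3)[OF that] by auto
  then interpret cell_map "strong_product {1..n} G" "mms_product {1..n} X"
      "\<lambda>\<omega>. \<lambda>i\<in>{1..n}. cell_index (k i) (\<omega> i)"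
    using assms(1) by (intro cell_map_product) auto
  have "card (pverts (G i)) = k i" if "i \<in> {1..n}" for i
    using assms(5)[OF that] by (auto simp: pverts_power)
  then have "card (pverts (strong_product {1..n} G)) = (\<Prod>i\<in>{1..n}. k i)"
    by (simp add: card_pverts_strong_product)
  then show ?thesis
    using mms_iso_le_graph_iso[of x] assms(7) by simp
qed

end
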